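(* Let $f_1,f_2:\mathbb{R}^n\to(-\infty,\infty]$ be proper closed convex functions such that $f_1$ is $\sigma_1$-convex and $f_2$ is $\sigma_2$-convex, with $\sigma_1,\sigma_2\ge 0$ and $\sigma_1+\sigma_2>0$. Assume that there is a closed set $Y\subseteq\mathbb{R}^n$ with $\mathrm{dom}(f_1)\subseteq Y\subseteq \mathrm{int}(\mathrm{dom}(f_2))$, and that $f:=f_1-f_2$ is bounded below, i.e. there is a scalar $f^*\in\mathbb{R}$ with $f(x)\ge f^*$ for all $x\in\mathbb{R}^n$. Let $\gamma\in[0,(\sigma_1+\sigma_2)/2)$ and let $\{x^k\}$ be a sequence generated by the exact refined inertial DC algorithm RInDCA$_{\mathrm e}$ with inertial step-size $\gamma$. Then: (i) $\lim_{k\to\infty}\|x^k-x^{k-1}\|=0$; (ii) if $\{x^k\}$ is bounded, then any limit point of $\{x^k\}$ is a critical point of the problem $\min\{f_1(x)-f_2(x):x\in\mathbb{R}^n\}$.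
   Context: $\mathrm{dom}(h)=\{x: h(x)<\infty\}$; $\|\cdot\|$ is the Euclidean norm; $\partial h$ denotes the convex subdifferential of a convex function $h$. The function $f=f_1-f_2$ takes the value $+\infty$ outside $\mathrm{dom}(f_1)$. A function is closed if its epigraph is closed. A proper closed function $h$ is $\sigma$-convex ($\sigma\ge0$) if for all $x,z\in\mathrm{dom}(h)$ and $\lambda\in[0,1]$: $h(\lambda x+(1-\lambda)z)\le\lambda h(x)+(1-\lambda)h(z)-\frac{\sigma}{2}\lambda(1-\lambda)\|x-z\|^2$. RInDCA$_{\mathrm e}$ (with step-size $\gamma$): start from $x^0\in\mathrm{dom}(f_1)$ and $x^{-1}=x^0$. For $k=0,1,2,\dots$, choose $y^k\in\partial f_2(x^k)$ and $x^{k+1}\in\operatorname{argmin}\{f_1(x)-\langle y^k+\gamma(x^k-x^{k-1}),x\rangle: x\in\mathbb{R}^n\}$ (equivalently $y^k+\gamma(x^k-x^{k-1})\in\partial f_1(x^{k+1})$). "A sequence generated by the algorithm" is any infinite sequence satisfying these relations. A point $\bar x$ is a critical point of the problem if $\partial f_1(\bar x)\cap\partial f_2(\bar x)\neq\emptyset$. *)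

theory Defs
  imports "HOL-Analysis.Analysis"
begin

definition eff_dom :: "('a \<Rightarrow> ereal) \<Rightarrow> 'a set" where
  "eff_dom h = {x. h x < \<infinity>}"

(* The library's epigraph is for real-valued functions only. *)
definition epi :: "('a \<Rightarrow> ereal) \<Rightarrow> ('a \<times> real) set" where
  "epi h = {(x, t). h x \<le> ereal t}"

definition proper_fun :: "('a \<Rightarrow> ereal) \<Rightarrow> bool" where
  "proper_fun h \<longleftrightarrow> (\<forall>x. h x \<noteq> -\<infinity>) \<and> eff_dom h \<noteq> {}"

definition closed_fun :: "('a::topological_space \<Rightarrow> ereal) \<Rightarrow> bool" where
  "closed_fun h \<longleftrightarrow> closed (epi h)"

definition convex_fun :: "('a::real_vector \<Rightarrow> ereal) \<Rightarrow> bool" where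
  "convex_fun h \<longleftrightarrow> convex (epi h)"

(* Meant for proper h, for which the right-hand side below is always finite. *)
definition sigma_convex :: "real \<Rightarrow> ('a::real_normed_vector \<Rightarrow> ereal) \<Rightarrow> bool" where
  "sigma_convex \<sigma> h \<longleftrightarrow>
     (\<forall>x\<in>eff_dom h. \<forall>z\<in>eff_dom h. \<forall>t\<in>{0..1}.
        h (t *\<^sub>R x + (1 - t) *\<^sub>R z)
          \<le> ereal t * h x + ereal (1 - t) * h z
            - ereal (\<sigma> / 2 * t * (1 - t) * (norm (x - z))\<^sup>2))"

(* Empty outside the effective domain. *)
definition subdifferential :: "('a::real_inner \<Rightarrow> ereal) \<Rightarrow> 'a \<Rightarrow> 'a set" where
  "subdifferential h x =
     {v. x \<in> eff_dom h \<and> (\<forall>z. h z \<ge> h x + ereal (v \<bullet> (z - x)))}"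

definition dc_diff :: "('a \<Rightarrow> ereal) \<Rightarrow> ('a \<Rightarrow> ereal) \<Rightarrow> 'a \<Rightarrow> ereal" where
  "dc_diff f1 f2 x = (if x \<in> eff_dom f1 then f1 x - f2 x else \<infinity>)"

definition critical_point ::
  "('a::real_inner \<Rightarrow> ereal) \<Rightarrow> ('a \<Rightarrow> ereal) \<Rightarrow> 'a \<Rightarrow> bool" where
  "critical_point f1 f2 x \<longleftrightarrow> subdifferential f1 x \<inter> subdifferential f2 x \<noteq> {}"

(* The iterate with index k - 1, where the one with index -1 is x 0. *)
definition prev_iterate :: "(nat \<Rightarrow> 'a) \<Rightarrow> nat \<Rightarrow> 'a" where
  "prev_iterate x k = (if k = 0 then x 0 else x (k - 1))"

definition RInDCA_e ::
  "('a::real_inner \<Rightarrow> ereal) \<Rightarrow> ('a \<Rightarrow> ereal) \<Rightarrow> real \<Rightarrow> (nat \<Rightarrow> 'a) \<Rightarrow> bool" where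
  "RInDCA_e f1 f2 \<gamma> x \<longleftrightarrow>
     x 0 \<in> eff_dom f1 \<and>
     (\<exists>y. \<forall>k. y k \<in> subdifferential f2 (x k) \<and>
        is_arg_min
          (\<lambda>u. f1 u - ereal ((y k + \<gamma> *\<^sub>R (x k - prev_iterate x k)) \<bullet> u))
          (\<lambda>u. u \<in> UNIV) (x (Suc k)))"

(* Limit of a subsequence; unlike islimpt on the range, this covers values taken
   infinitely often. *)
definition seq_limit_point :: "(nat \<Rightarrow> 'a::topological_space) \<Rightarrow> 'a \<Rightarrow> bool" where
  "seq_limit_point x l \<longleftrightarrow> (\<exists>r. strict_mono r \<and> (x \<circ> r) \<longlonglongrightarrow> l)"

end

theory Submission
  imports Defs
begin

text \<open>
  Adding the strong subgradient inequalities of \<open>f1\<close> at \<open>x (k+1)\<close> and of \<open>f2\<close> at \<open>x k\<close> and bounding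
  the inertial cross term by Young's inequality shows that the energy
  \<open>f (x k) + \<gamma>/2 * \<parallel>x k - x (k-1)\<parallel>\<^sup>2\<close> drops in each step by at least
  \<open>((\<sigma>1 + \<sigma>2)/2 - \<gamma>) * \<parallel>x (k+1) - x k\<parallel>\<^sup>2\<close>; being bounded below, it makes the squared steps
  summable. A limit point lies in the interior of \<open>dom f2\<close>, near which the subgradients of
  \<open>f2\<close> are bounded, so they have a convergent subsequence; as the steps vanish, its
  limit is also the limit of the subgradients of \<open>f1\<close>, and subdifferentials have closed graph.
\<close>

lemma eff_dom_finite:
  assumes "proper_fun h" "x \<in> eff_dom h"
  shows "h x = ereal (real_of_ereal (h x))"
  using assms by (cases "h x") (auto simp: proper_fun_def eff_dom_def)

text \<open>Test the subgradient inequality at \<open>t *\<^sub>R z + (1 - t) *\<^sub>R x\<close>,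
  bound \<open>h\<close> there by \<open>sigma_convex\<close>, divide by \<open>t\<close> and let
  \<open>t\<close> tend to 0 from the right: the factor \<open>1 - t\<close> in front of the
  quadratic term disappears.\<close>

lemma strong_subgradient:
  assumes h: "proper_fun h" "sigma_convex \<sigma> h"
    and v: "v \<in> subdifferential h x" and z: "z \<in> eff_dom h"
  shows "real_of_ereal (h x) + v \<bullet> (z - x) + \<sigma> / 2 * (norm (z - x))\<^sup>2 \<le> real_of_ereal (h z)"
proof -
  define a where "a = real_of_ereal (h x)"
  define c where "c = real_of_ereal (h z)"
  have x: "x \<in> eff_dom h" using v by (simp add: subdifferential_def)
  have a: "h x = ereal a" and c: "h z = ereal c"
    using eff_dom_finite h x z by (auto simp: a_def c_def)
  have "v \<bullet> (z - x) + \<sigma> / 2 * (1 - t) * (norm (z - x))\<^sup>2 \<le> c - a" if t: "0 < t" "t < 1" for t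
  proof -
    let ?p = "t *\<^sub>R z + (1 - t) *\<^sub>R x"
    have "h x + ereal (v \<bullet> (?p - x)) \<le> h ?p"
      using v by (simp add: subdifferential_def)
    also have "h ?p \<le> ereal t * h z + ereal (1 - t) * h x
        - ereal (\<sigma> / 2 * t * (1 - t) * (norm (z - x))\<^sup>2)"
      using h(2) x z t unfolding sigma_convex_def by (meson atLeastAtMost_iff less_imp_le)
    finally have "a + v \<bullet> (?p - x) \<le> t * c + (1 - t) * a - \<sigma> / 2 * t * (1 - t) * (norm (z - x))\<^sup>2"
      by (simp add: a c)
    moreover have "?p - x = t *\<^sub>R (z - x)" by (simp add: algebra_simps)
    ultimately have "t * (v \<bullet> (z - x) + \<sigma> / 2 * (1 - t) * (norm (z - x))\<^sup>2) \<le> t * (c - a)"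
      by (simp add: algebra_simps)
    then show ?thesis using t by simp
  qed
  then have "\<forall>\<^sub>F t in at_right 0. v \<bullet> (z - x) + \<sigma> / 2 * (1 - t) * (norm (z - x))\<^sup>2 \<le> c - a"
    unfolding eventually_at_right_field by (intro exI[of _ 1]) auto
  moreover have "((\<lambda>t. v \<bullet> (z - x) + \<sigma> / 2 * (1 - t) * (norm (z - x))\<^sup>2) \<longlongrightarrow>
      v \<bullet> (z - x) + \<sigma> / 2 * (1 - 0) * (norm (z - x))\<^sup>2) (at_right 0)"
    by (intro tendsto_intros)
  ultimately have "v \<bullet> (z - x) + \<sigma> / 2 * (1 - 0) * (norm (z - x))\<^sup>2 \<le> c - a"
    by (intro tendsto_upperbound[of _ _ "at_right (0::real)"]) auto
  then show ?thesis by (simp add: a_def c_def)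
qed

text \<open>For fixed \<open>z\<close> with finite \<open>h z\<close>, each subgradient inequality
  says that a certain point lies in \<open>epi h\<close>. These points converge, and membership of
  the limit is the inequality at \<open>xbar\<close>. Going through the closed epigraph means that
  \<open>h (x j)\<close> need not converge.\<close>

lemma subdifferential_closed_graph:
  assumes h: "proper_fun h" "closed_fun h"
    and v: "\<And>j. v j \<in> subdifferential h (x j)"
    and lim: "x \<longlonglongrightarrow> xbar" "v \<longlonglongrightarrow> vbar"
  shows "vbar \<in> subdifferential h xbar"
proof -
  have below: "h xbar \<le> ereal (c - vbar \<bullet> (z - xbar))" if c: "h z = ereal c" for z c
  proof -
    have "(x j, c - v j \<bullet> (z - x j)) \<in> epi h" for j
    proof -
      have "h (x j) + ereal (v j \<bullet> (z - x j)) \<le> ereal c"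
        using v[of j] c by (simp add: subdifferential_def flip: c)
      then show ?thesis by (cases "h (x j)") (auto simp: epi_def)
    qed
    moreover have "(\<lambda>j. (x j, c - v j \<bullet> (z - x j))) \<longlonglongrightarrow> (xbar, c - vbar \<bullet> (z - xbar))"
      by (intro tendsto_intros lim)
    ultimately have "(xbar, c - vbar \<bullet> (z - xbar)) \<in> epi h"
      using h(2) unfolding closed_fun_def by (rule closed_sequentially[rotated])
    then show ?thesis by (simp add: epi_def)
  qed
  \<comment> \<open>The subdifferential is empty off the domain, so \<open>h xbar\<close> must first
    be shown finite; \<open>x 0\<close> serves as a test point with finite value.\<close>
  have "x 0 \<in> eff_dom h" using v[of 0] by (simp add: subdifferential_def)
  from below[OF eff_dom_finite[OF h(1) this]] have "h xbar < \<infinity>"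
    by (cases "h xbar") auto
  then have dom: "xbar \<in> eff_dom h" by (simp add: eff_dom_def)
  then obtain a where a: "h xbar = ereal a" using eff_dom_finite[OF h(1)] by blast
  have "h xbar + ereal (vbar \<bullet> (z - xbar)) \<le> h z" for z
  proof (cases "h z")
    case (real c)
    then show ?thesis using below[OF real] by (simp add: a)
  next
    case MInf
    then show ?thesis using h(1) by (simp add: proper_fun_def)
  qed simp
  then show ?thesis using dom by (simp add: subdifferential_def)
qed

text \<open>Passes to a real-valued function on an open set, where convexity implies continuity. The
  domain is convex as the projection of the epigraph.\<close>

lemma convex_on_interior_eff_dom:
  fixes h :: "'a::real_normed_vector \<Rightarrow> ereal"
  assumes "proper_fun h" "convex_fun h"
  shows "convex_on (interior (eff_dom h)) (\<lambda>u. real_of_ereal (h u))"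
proof -
  have eq: "eff_dom h = fst ` epi h"
  proof
    show "eff_dom h \<subseteq> fst ` epi h"
    proof
      fix u assume "u \<in> eff_dom h"
      then have "(u, real_of_ereal (h u)) \<in> epi h"
        using eff_dom_finite[OF assms(1)] by (simp add: epi_def)
      then show "u \<in> fst ` epi h" by force
    qed
    show "fst ` epi h \<subseteq> eff_dom h" by (auto simp: epi_def eff_dom_def)
  qed
  have "convex (eff_dom h)"
    unfolding eq using assms(2) by (intro convex_linear_image linear_fst) (simp add: convex_fun_def)
  moreover have "convex_on (eff_dom h) (\<lambda>u. real_of_ereal (h u))"
  proof (rule convex_onI)
    fix t u w assume t: "0 < t" "t < (1::real)" and u: "u \<in> eff_dom h" and w: "w \<in> eff_dom h"
    let ?p = "(1 - t) *\<^sub>R u + t *\<^sub>R w"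
    have "(u, real_of_ereal (h u)) \<in> epi h" "(w, real_of_ereal (h w)) \<in> epi h"
      using eff_dom_finite[OF assms(1)] u w by (simp_all add: epi_def)
    then have "(1 - t) *\<^sub>R (u, real_of_ereal (h u)) + t *\<^sub>R (w, real_of_ereal (h w)) \<in> epi h"
      using assms(2) t unfolding convex_fun_def by (intro convexD) auto
    then have le: "h ?p \<le> ereal ((1 - t) * real_of_ereal (h u) + t * real_of_ereal (h w))"
      by (simp add: epi_def)
    then have "?p \<in> eff_dom h" by (auto simp: eff_dom_def)
    from eff_dom_finite[OF assms(1) this] le
    show "real_of_ereal (h ?p) \<le> (1 - t) * real_of_ereal (h u) + t * real_of_ereal (h w)"
      by (metis ereal_less_eq(3))
  qed fact
  ultimately show ?thesis
    by (auto intro: convex_on_subset[OF _ interior_subset])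
qed

text \<open>By continuity \<open>h\<close> is bounded by some \<open>B\<close> on a small closed
  ball. A long subgradient at a point near the centre would force \<open>h\<close> to grow by more
  than \<open>2 * B\<close> within that ball.\<close>

lemma subdifferential_locally_bounded:
  fixes h :: "'a::euclidean_space \<Rightarrow> ereal"
  assumes h: "proper_fun h" "convex_fun h" and p: "p \<in> interior (eff_dom h)"
  obtains e B where "e > 0" "\<And>u v. u \<in> ball p e \<Longrightarrow> v \<in> subdifferential h u \<Longrightarrow> norm v \<le> B"
proof -
  let ?g = "\<lambda>u. real_of_ereal (h u)"
  obtain d where d: "d > 0" "cball p d \<subseteq> interior (eff_dom h)"
    using p open_contains_cball open_interior by meson
  have "continuous_on (interior (eff_dom h)) ?g"
    using convex_on_interior_eff_dom[OF h] by (intro convex_on_continuous) auto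
  then have "bounded (?g ` cball p d)"
    using d(2) by (intro compact_imp_bounded compact_continuous_image) (auto intro: continuous_on_subset)
  then obtain B where B: "\<And>u. u \<in> cball p d \<Longrightarrow> \<bar>?g u\<bar> \<le> B"
    unfolding bounded_iff by (metis imageI real_norm_def)
  have "norm v \<le> 4 * B / d" if u: "u \<in> ball p (d/2)" and v: "v \<in> subdifferential h u" for u v
  proof -
    \<comment> \<open>A step of length \<open>d/2\<close> along \<open>v\<close>, the direction of
      steepest predicted growth. It stays in \<open>cball p d\<close> because \<open>u\<close> is
      within \<open>d/2\<close> of \<open>p\<close>; for \<open>v = 0\<close> it gives
      \<open>z = u\<close>.\<close>
    define z where "z = u + (d/2) *\<^sub>R sgn v"
    have "dist p z \<le> dist p u + norm ((d/2) *\<^sub>R sgn v)"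
      unfolding z_def dist_norm by (metis diff_diff_add norm_triangle_ineq4)
    also have "\<dots> \<le> d"
      using u d(1) by (simp add: norm_sgn)
    finally have z: "z \<in> cball p d" by simp
    have uc: "u \<in> cball p d" using u d(1) by simp
    have "h u + ereal (v \<bullet> (z - u)) \<le> h z" using v by (simp add: subdifferential_def)
    moreover have "h u = ereal (?g u)" "h z = ereal (?g z)"
      using eff_dom_finite[OF h(1)] d(2) uc z interior_subset by blast+
    ultimately have "?g u + v \<bullet> (z - u) \<le> ?g z"
      by (metis ereal_less_eq(3) plus_ereal.simps(1))
    moreover have "v \<bullet> (z - u) = d / 2 * norm v"
      by (cases "v = 0") (simp_all add: z_def sgn_div_norm power2_norm_eq_inner[symmetric] power2_eq_square)
    ultimately have "d / 2 * norm v \<le> 2 * B"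
      using B[OF uc] B[OF z] by linarith
    then show ?thesis using d(1) by (simp add: field_simps)
  qed
  then show thesis using that[of "d/2" "4 * B / d"] d(1) by simp
qed

text \<open>Minimality rearranges to the subgradient inequality once \<open>h p\<close> is known to
  be finite, which follows by comparison with any point of the domain.\<close>

lemma arg_min_imp_subgradient:
  assumes h: "proper_fun h"
    and m: "is_arg_min (\<lambda>u. h u - ereal (w \<bullet> u)) (\<lambda>u. u \<in> UNIV) p"
  shows "w \<in> subdifferential h p"
proof -
  have min: "h p - ereal (w \<bullet> p) \<le> h u - ereal (w \<bullet> u)" for u
    using m by (auto simp: is_arg_min_def not_less)
  obtain u where u: "u \<in> eff_dom h" using h by (auto simp: proper_fun_def)
  have p: "p \<in> eff_dom h"
    using min[of u] eff_dom_finite[OF h u] by (cases "h p"; cases "h u") (auto simp: eff_dom_def)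
  then obtain a where a: "h p = ereal a" using eff_dom_finite[OF h] by blast
  have "h p + ereal (w \<bullet> (z - p)) \<le> h z" for z
    using min[of z] by (cases "h z") (auto simp: a algebra_simps)
  then show ?thesis using p by (simp add: subdifferential_def)
qed

text \<open>\<open>E\<close> is decreasing and bounded below, hence convergent, and \<open>s\<close>
  is squeezed between 0 and its vanishing decrements.\<close>

lemma nonneg_decrease_tendsto_zero:
  fixes E s :: "nat \<Rightarrow> real"
  assumes dec: "\<And>k. E (Suc k) + s k \<le> E k" and s: "\<And>k. 0 \<le> s k" and low: "\<And>k. m \<le> E k"
  shows "s \<longlonglongrightarrow> 0"
proof -
  have "decseq E" using dec s by (intro decseq_SucI) (smt (verit))
  then obtain L where L: "E \<longlonglongrightarrow> L" using low decseq_convergent by metis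
  have "(\<lambda>k. E k - E (Suc k)) \<longlonglongrightarrow> L - L"
    by (intro tendsto_diff L LIMSEQ_Suc)
  then have "(\<lambda>k. E k - E (Suc k)) \<longlonglongrightarrow> 0" by simp
  then show ?thesis
    by (rule tendsto_sandwich[OF _ _ tendsto_const, rotated 2])
      (use dec s in \<open>auto intro: always_eventually simp: le_diff_eq add.commute\<close>)
qed

theorem theorem1:
  fixes f1 f2 :: "real ^ 'n \<Rightarrow> ereal"
    and \<sigma>1 \<sigma>2 \<gamma> :: real
    and x :: "nat \<Rightarrow> real ^ 'n"
  assumes "proper_fun f1" and "closed_fun f1" and "convex_fun f1"
    and "proper_fun f2" and "closed_fun f2" and "convex_fun f2"
    and "sigma_convex \<sigma>1 f1" and "sigma_convex \<sigma>2 f2"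
    and "\<sigma>1 \<ge> 0" and "\<sigma>2 \<ge> 0" and "\<sigma>1 + \<sigma>2 > 0"
    and "\<exists>Y. closed Y \<and> eff_dom f1 \<subseteq> Y \<and> Y \<subseteq> interior (eff_dom f2)"
    and "\<exists>fstar::real. \<forall>u. dc_diff f1 f2 u \<ge> ereal fstar"
    and "\<gamma> \<in> {0..<(\<sigma>1 + \<sigma>2) / 2}"
    and "RInDCA_e f1 f2 \<gamma> x"
  shows "(\<lambda>k. norm (x k - prev_iterate x k)) \<longlonglongrightarrow> 0 \<and>
         (bounded (range x) \<longrightarrow>
            (\<forall>xbar. seq_limit_point x xbar \<longrightarrow> critical_point f1 f2 xbar))"
proof -
  note f1 = \<open>proper_fun f1\<close> and f2 = \<open>proper_fun f2\<close>
  \<comment> \<open>\<open>d 0 = 0\<close> by the convention for index -1; the step from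
    \<open>x k\<close> to \<open>x (Suc k)\<close> is \<open>d (Suc k)\<close>.\<close>
  define d where "d k = x k - prev_iterate x k" for k
  have d_Suc: "d (Suc k) = x (Suc k) - x k" for k by (simp add: d_def prev_iterate_def)
  from \<open>RInDCA_e f1 f2 \<gamma> x\<close> obtain y where x0: "x 0 \<in> eff_dom f1"
    and y: "\<And>k. y k \<in> subdifferential f2 (x k)"
    and am: "\<And>k. is_arg_min (\<lambda>u. f1 u - ereal ((y k + \<gamma> *\<^sub>R d k) \<bullet> u)) (\<lambda>u. u \<in> UNIV) (x (Suc k))"
    unfolding RInDCA_e_def d_def by blast
  obtain Y where Y: "closed Y" "eff_dom f1 \<subseteq> Y" "Y \<subseteq> interior (eff_dom f2)"
    using assms by blast
  obtain fstar where fstar: "\<And>u. dc_diff f1 f2 u \<ge> ereal fstar"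
    using assms by blast
  have \<gamma>: "0 \<le> \<gamma>" "0 < (\<sigma>1 + \<sigma>2) / 2 - \<gamma>" using assms by auto
  have w: "y k + \<gamma> *\<^sub>R d k \<in> subdifferential f1 (x (Suc k))" for k
    using arg_min_imp_subgradient[OF f1 am] .
  have dom1: "x k \<in> eff_dom f1" for k
    using x0 w by (cases k) (auto simp: subdifferential_def)
  then have dom2: "x k \<in> eff_dom f2" for k
    using Y interior_subset by blast

  \<comment> \<open>The iterates lie in both domains, so the energy can be handled in real
    arithmetic.\<close>
  define g1 where "g1 k = real_of_ereal (f1 (x k))" for k
  define g2 where "g2 k = real_of_ereal (f2 (x k))" for k
  define E where "E k = g1 k - g2 k + \<gamma> / 2 * (norm (d k))\<^sup>2" for k
  define s where "s k = ((\<sigma>1 + \<sigma>2) / 2 - \<gamma>) * (norm (d (Suc k)))\<^sup>2" for k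
  have "E (Suc k) + s k \<le> E k" for k
  proof -
    have "g1 (Suc k) + (y k + \<gamma> *\<^sub>R d k) \<bullet> (x k - x (Suc k)) + \<sigma>1 / 2 * (norm (d (Suc k)))\<^sup>2 \<le> g1 k"
      using strong_subgradient[OF f1 \<open>sigma_convex \<sigma>1 f1\<close> w dom1, of k k]
      by (simp add: g1_def d_Suc norm_minus_commute)
    moreover have "g2 k + y k \<bullet> (x (Suc k) - x k) + \<sigma>2 / 2 * (norm (d (Suc k)))\<^sup>2 \<le> g2 (Suc k)"
      using strong_subgradient[OF f2 \<open>sigma_convex \<sigma>2 f2\<close> y dom2, of k "Suc k"]
      by (simp add: g2_def d_Suc)
    \<comment> \<open>The terms with \<open>y k\<close> cancel, leaving only the inertial cross
      term.\<close>
    moreover have "(y k + \<gamma> *\<^sub>R d k) \<bullet> (x k - x (Suc k)) + y k \<bullet> (x (Suc k) - x k)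
        = - (\<gamma> * (d k \<bullet> d (Suc k)))"
      by (simp add: d_Suc algebra_simps)
    \<comment> \<open>Young's inequality with equal weights: the half with \<open>d k\<close> is the
      inertial part of \<open>E k\<close>. The half with \<open>d (Suc k)\<close> and the inertial
      part of \<open>E (Suc k)\<close> together cost \<gamma>, whence the coefficient in
      \<open>s\<close>.\<close>
    moreover have "\<gamma> * (d k \<bullet> d (Suc k)) \<le> \<gamma> * ((norm (d k))\<^sup>2 / 2 + (norm (d (Suc k)))\<^sup>2 / 2)"
    proof (rule mult_left_mono[OF _ \<gamma>(1)])
      have "0 \<le> (d k - d (Suc k)) \<bullet> (d k - d (Suc k))" by simp
      then show "d k \<bullet> d (Suc k) \<le> (norm (d k))\<^sup>2 / 2 + (norm (d (Suc k)))\<^sup>2 / 2"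
        by (simp add: power2_norm_eq_inner algebra_simps inner_commute)
    qed
    \<comment> \<open>This identity and the next are expanded so that \<open>linarith\<close> meets
      the same products as atoms throughout.\<close>
    moreover have "s k = \<sigma>1 / 2 * (norm (d (Suc k)))\<^sup>2 + \<sigma>2 / 2 * (norm (d (Suc k)))\<^sup>2
        - \<gamma> * (norm (d (Suc k)))\<^sup>2"
      by (simp add: s_def algebra_simps add_divide_distrib)
    moreover have "\<gamma> * ((norm (d k))\<^sup>2 / 2 + (norm (d (Suc k)))\<^sup>2 / 2)
        = \<gamma> / 2 * (norm (d k))\<^sup>2 + \<gamma> / 2 * (norm (d (Suc k)))\<^sup>2"
      by (simp add: algebra_simps)
    ultimately show ?thesis unfolding E_def by linarith
  qed
  moreover have "0 \<le> s k" for k using \<gamma> by (simp add: s_def)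
  moreover have "fstar \<le> E k" for k
  proof -
    have "f1 (x k) = ereal (g1 k)" "f2 (x k) = ereal (g2 k)"
      using eff_dom_finite[OF f1 dom1] eff_dom_finite[OF f2 dom2] by (simp_all only: g1_def g2_def)
    then have "fstar \<le> g1 k - g2 k"
      using fstar[of "x k"] dom1[of k] by (simp add: dc_diff_def)
    then show ?thesis using \<gamma>(1) by (simp add: E_def add_increasing2)
  qed
  ultimately have "s \<longlonglongrightarrow> 0" by (rule nonneg_decrease_tendsto_zero)
  then have "(\<lambda>k. s k / ((\<sigma>1 + \<sigma>2) / 2 - \<gamma>)) \<longlonglongrightarrow> 0"
    by (rule tendsto_divide_zero)
  then have "(\<lambda>k. (norm (d (Suc k)))\<^sup>2) \<longlonglongrightarrow> 0"
    using \<gamma>(2) by (simp add: s_def)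
  then have "(\<lambda>k. d (Suc k)) \<longlonglongrightarrow> 0"
    by (simp add: tendsto_norm_zero_iff)
  then have d0: "d \<longlonglongrightarrow> 0" by (simp add: filterlim_sequentially_Suc)

  have "critical_point f1 f2 xbar" if lp: "seq_limit_point x xbar" for xbar
  proof -
    obtain r where r: "strict_mono r" "(x \<circ> r) \<longlonglongrightarrow> xbar"
      using lp by (auto simp: seq_limit_point_def)
    \<comment> \<open>The domain of \<open>f1\<close> may fail to be closed; the closed set
      \<open>Y\<close> keeps the limit inside the interior of the domain of
      \<open>f2\<close>.\<close>
    have "xbar \<in> Y"
      using closed_sequentially[OF Y(1) _ r(2)] dom1 Y(2) by auto
    then have "xbar \<in> interior (eff_dom f2)" using Y(3) by blast
    from subdifferential_locally_bounded[OF f2 \<open>convex_fun f2\<close> this]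
    obtain e B where e: "e > 0"
      and B: "\<And>u v. u \<in> ball xbar e \<Longrightarrow> v \<in> subdifferential f2 u \<Longrightarrow> norm v \<le> B" by blast
    obtain N where N: "\<And>j. j \<ge> N \<Longrightarrow> x (r j) \<in> ball xbar e"
      using metric_LIMSEQ_D[OF r(2) e] by (auto simp: dist_commute)
    \<comment> \<open>The shift by \<open>N\<close> drops the terms outside the ball, so that the
      bound holds for the whole sequence.\<close>
    have "bounded (range (\<lambda>j. y (r (j + N))))"
      using B[OF N y] by (auto simp: bounded_iff intro!: exI[of _ B])
    then obtain ybar q where q: "strict_mono q" "((\<lambda>j. y (r (j + N))) \<circ> q) \<longlonglongrightarrow> ybar"
      using bounded_imp_convergent_subsequence by blast
    define p where "p j = r (q j + N)" for j
    have p: "strict_mono p"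
      using r(1) q(1) by (auto simp: p_def strict_mono_def)
    have "strict_mono (\<lambda>j. q j + N)" using q(1) by (simp add: strict_mono_def)
    from LIMSEQ_subseq_LIMSEQ[OF r(2) this]
    have xp: "(\<lambda>j. x (p j)) \<longlonglongrightarrow> xbar" by (simp add: p_def o_def)
    have yp: "(\<lambda>j. y (p j)) \<longlonglongrightarrow> ybar" using q(2) by (simp add: p_def o_def)
    \<comment> \<open>Vanishing steps are used at two indices: \<open>d (p j)\<close> perturbs the
      subgradient of \<open>f1\<close>, while \<open>d (Suc (p j))\<close> separates its base point
      \<open>x (Suc (p j))\<close> from \<open>x (p j)\<close>, the base point of
      \<open>y (p j)\<close>.\<close>
    have dp: "(\<lambda>j. d (p j)) \<longlonglongrightarrow> 0"
      using LIMSEQ_subseq_LIMSEQ[OF d0 p] by (simp add: o_def)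
    have "strict_mono (\<lambda>j. Suc (p j))" using p by (simp add: strict_mono_def)
    from LIMSEQ_subseq_LIMSEQ[OF d0 this]
    have "(\<lambda>j. d (Suc (p j))) \<longlonglongrightarrow> 0" by (simp add: o_def)
    from tendsto_add[OF xp this]
    have xs: "(\<lambda>j. x (Suc (p j))) \<longlonglongrightarrow> xbar" by (simp add: d_Suc)
    have wp: "(\<lambda>j. y (p j) + \<gamma> *\<^sub>R d (p j)) \<longlonglongrightarrow> ybar"
      using tendsto_add[OF yp tendsto_scaleR[OF tendsto_const dp]] by simp
    have "ybar \<in> subdifferential f1 xbar"
      using subdifferential_closed_graph[OF f1 \<open>closed_fun f1\<close> w xs wp] .
    moreover have "ybar \<in> subdifferential f2 xbar"
      using subdifferential_closed_graph[OF f2 \<open>closed_fun f2\<close> y xp yp] .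
    ultimately show ?thesis by (auto simp: critical_point_def)
  qed
  moreover have "(\<lambda>k. norm (x k - prev_iterate x k)) \<longlonglongrightarrow> 0"
    using tendsto_norm_zero[OF d0] by (simp add: d_def)
  ultimately show ?thesis by blast
qed

end
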